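(* Let $0\leqslant\alpha<1$, $\beta>0$ and let $n\geqslant 1$ be an integer. Let $\mathcal{F}_{\alpha,\beta,n}$ be the family of all functions $F(z)=f(z)(Q(z))^{\beta/n}$ on $\mathbb{D}$, where $f\in\mathcal{ST}(\alpha)$ and $Q$ is a polynomial of degree $n$ with $Q(0)=1$ and all zeros in $\mathbb{C}\setminus\mathbb{D}$. Then the radius of starlikeness associated with a nephroid domain of this family, that is, the largest $R\in(0,1)$ such that $z\mapsto r^{-1}F(rz)$ belongs to $\mathcal{S}^{*}_{Ne}$ for all $F\in\mathcal{F}_{\alpha,\beta,n}$ and all $0<r<R$, is \[R_{\mathcal{S}^{*}_{Ne}}(F)=\begin{cases}\sigma_0 & \text{if } 2\alpha+\beta-2\geqslant 0,\\ \tilde{\sigma}_0 & \text{if } 2\alpha+\beta-2<0,\end{cases}\] where \[\sigma_0=\dfrac{4}{3(2-2\alpha+\beta)+\sqrt{9(-2+2\alpha-\beta)^2-8(4-6\alpha-3\beta)}}\] and \[\tilde{\sigma}_0=\dfrac{4}{3(2-2\alpha+\beta)+\sqrt{9(-2+2\alpha-\beta)^2-8(6\alpha-8+3\beta)}}.\]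
   Context: $\mathbb{D}=\{z\in\mathbb{C}:|z|<1\}$. $\mathcal{A}$ is the class of analytic functions $f$ on $\mathbb{D}$ with $f(0)=0$, $f'(0)=1$. For $0\leqslant\alpha<1$, $\mathcal{ST}(\alpha)$ (starlike functions of order $\alpha$) is the class of $f\in\mathcal{A}$ with $\operatorname{Re}(zf'(z)/f(z))>\alpha$ for all $z\in\mathbb{D}$ (the quotient being given the value $1$ at $z=0$). For analytic $g,h$ on $\mathbb{D}$, $g\prec h$ (subordination) means $g=h\circ w$ for some analytic $w:\mathbb{D}\to\mathbb{D}$ with $w(0)=0$. $\mathcal{S}^{*}_{Ne}$ (starlike functions associated with a nephroid domain) is the class of $f\in\mathcal{A}$ with $zf'(z)/f(z)\prec\varphi_{Ne}(z)$, where $\varphi_{Ne}(z)=1+z-z^3/3$. Since $Q$ is non-vanishing in $\mathbb{D}$ and $Q(0)=1$, $(Q(z))^{\beta/n}$ denotes the analytic branch on $\mathbb{D}$ equal to $1$ at $z=0$, so $F\in\mathcal{A}$. *)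

theory Defs
  imports "HOL-Complex_Analysis.Complex_Analysis"
begin

text \<open>Functions on the unit disk are represented by total functions \<open>complex \<Rightarrow> complex\<close>;
  all notions below depend only on their values on the disk.\<close>

abbreviation unit_disk :: "complex set" (\<open>\<bbbD>\<close>)
  where "\<bbbD> \<equiv> ball 0 1"

definition class_A :: "(complex \<Rightarrow> complex) set" where
  "class_A = {f. f holomorphic_on \<bbbD> \<and> f 0 = 0 \<and> deriv f 0 = 1}"

definition starlike_quotient :: "(complex \<Rightarrow> complex) \<Rightarrow> complex \<Rightarrow> complex" where
  "starlike_quotient f z = (if z = 0 then 1 else z * deriv f z / f z)"

text \<open>The requirement \<open>f z \<noteq> 0\<close> below, and in the nephroid class, says that the quotient is
  defined on the punctured disk. It is implicit in the conditions on the quotient and is spelled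
  out here only because of the convention \<open>x / 0 = 0\<close>.\<close>

definition starlike_of_order :: "real \<Rightarrow> (complex \<Rightarrow> complex) set" where
  "starlike_of_order \<alpha> =
     {f \<in> class_A. (\<forall>z\<in>\<bbbD> - {0}. f z \<noteq> 0) \<and> (\<forall>z\<in>\<bbbD>. Re (starlike_quotient f z) > \<alpha>)}"

definition subordinate :: "(complex \<Rightarrow> complex) \<Rightarrow> (complex \<Rightarrow> complex) \<Rightarrow> bool"
    (infix \<open>\<prec>\<^sub>D\<close> 50) where
  "g \<prec>\<^sub>D h \<longleftrightarrow>
     g holomorphic_on \<bbbD> \<and> h holomorphic_on \<bbbD> \<and>
     (\<exists>w. w holomorphic_on \<bbbD> \<and> w ` \<bbbD> \<subseteq> \<bbbD> \<and> w 0 = 0 \<and> (\<forall>z\<in>\<bbbD>. g z = h (w z)))"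

definition nephroid_map :: "complex \<Rightarrow> complex" where
  "nephroid_map z = 1 + z - z ^ 3 / 3"

definition nephroid_starlike :: "(complex \<Rightarrow> complex) set" where
  "nephroid_starlike =
     {f \<in> class_A. (\<forall>z\<in>\<bbbD> - {0}. f z \<noteq> 0) \<and> starlike_quotient f \<prec>\<^sub>D nephroid_map}"

text \<open>\<open>is_power_branch q c g\<close>: on the disk, \<open>g\<close> is the branch of \<open>q\<^sup>c = exp (c log q)\<close> with
  \<open>g 0 = 1\<close>, where \<open>L\<close> is an analytic logarithm of \<open>q\<close>. Any two logarithms \<open>L\<close> differ by a
  constant, so the normalisation determines \<open>g\<close> on the disk.\<close>

definition is_power_branch ::
    "(complex \<Rightarrow> complex) \<Rightarrow> real \<Rightarrow> (complex \<Rightarrow> complex) \<Rightarrow> bool" where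
  "is_power_branch q c g \<longleftrightarrow>
     (\<exists>L. L holomorphic_on \<bbbD> \<and> (\<forall>z\<in>\<bbbD>. exp (L z) = q z \<and> g z = exp (of_real c * L z))) \<and>
     g 0 = 1"

definition product_family :: "real \<Rightarrow> real \<Rightarrow> nat \<Rightarrow> (complex \<Rightarrow> complex) set" where
  "product_family \<alpha> \<beta> n =
     {F. \<exists>f Q g. f \<in> starlike_of_order \<alpha> \<and>
           degree Q = n \<and> poly Q 0 = 1 \<and> (\<forall>z. poly Q z = 0 \<longrightarrow> z \<notin> \<bbbD>) \<and>
           is_power_branch (poly Q) (\<beta> / real n) g \<and>
           (\<forall>z\<in>\<bbbD>. F z = f z * g z)}"

definition admissible_radii ::
    "(complex \<Rightarrow> complex) set \<Rightarrow> (complex \<Rightarrow> complex) set \<Rightarrow> real set" where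
  "admissible_radii \<S> \<F> =
     {R. 0 < R \<and> R < 1 \<and>
         (\<forall>F\<in>\<F>. \<forall>r. 0 < r \<and> r < R \<longrightarrow>
            (\<lambda>z. F (of_real r * z) / of_real r) \<in> \<S>)}"

definition is_class_radius ::
    "(complex \<Rightarrow> complex) set \<Rightarrow> (complex \<Rightarrow> complex) set \<Rightarrow> real \<Rightarrow> bool" where
  "is_class_radius \<S> \<F> R \<longleftrightarrow>
     R \<in> admissible_radii \<S> \<F> \<and> (\<forall>R'\<in>admissible_radii \<S> \<F>. R' \<le> R)"

end

theory Submission
  imports Defs "HOL-Computational_Algebra.Fundamental_Theorem_Algebra"
begin

text \<open>Write \<open>q = z F'/F = z f'/f + (\<beta>/n) z Q'/Q\<close>. For \<open>\<bar>z\<bar> = t\<close>, the Schwarz lemma (for \<open>f\<close>) and a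
  Moebius estimate for each factor of \<open>Q\<close> put \<open>q z\<close> in the disc with centre
  \<open>a = (1 + (1 - 2\<alpha> - \<beta>) t\<^sup>2) / (1 - t\<^sup>2)\<close> and radius \<open>(2 - 2\<alpha> + \<beta>) t / (1 - t\<^sup>2)\<close>. The distance
  from a real \<open>a \<in> [1/3, 5/3]\<close> to the nephroid curve is \<open>min (a - 1/3) (5/3 - a)\<close>, attained at a
  cusp, so below the claimed radius the connected set \<open>q ` \<bbbD>\<close> contains \<open>1\<close> and misses the
  curve; univalence of the nephroid map then gives subordination. Since
  \<open>a \<le> 1\<close> iff \<open>2\<alpha> + \<beta> - 2 \<ge> 0\<close>, the sign of \<open>2\<alpha> + \<beta> - 2\<close> decides which cusp matters.
  For \<open>F z = z (1 + z)\<^sup>\<beta> / (1 - z)\<^sup>2\<^sup>-\<^sup>2\<^sup>\<alpha>\<close> the quotient at \<open>-t\<close> or \<open>t\<close> is the extreme real point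
  of the disc, and it leaves the real section \<open>(1/3, 5/3)\<close> of the nephroid domain beyond
  the claimed radius.\<close>

section \<open>Holomorphy of \<open>z f'/f\<close>, and discs for the half-plane and polynomial
  summands\<close>

text \<open>Dividing out the zero at the origin gives \<open>f z = z * h z\<close> with
  \<open>h\<close> zero-free on the disk, so the quotient equals \<open>1 + z h'/h\<close>; the
  value 1 at the origin removes the singularity.\<close>

lemma holomorphic_starlike_quotient:
  assumes f: "f \<in> class_A" and nz: "\<forall>z\<in>\<bbbD> - {0}. f z \<noteq> 0"
  shows "starlike_quotient f holomorphic_on \<bbbD>"
proof -
  have hf: "f holomorphic_on ball 0 1" and f0: "f 0 = 0" and d1: "deriv f 0 = 1"
    using f by (auto simp: class_A_def)
  obtain h where h: "h holomorphic_on ball 0 1" and fh: "\<And>z. norm z < 1 \<Longrightarrow> f z = z * h z"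
    and h0: "deriv f 0 = h 0"
    using Schwarz3[OF hf f0] by blast
  have hnz: "h z \<noteq> 0" if "z \<in> \<bbbD>" for z
    using nz fh[of z] h0 d1 that by (cases "z = 0") auto
  have eq: "1 + z * deriv h z / h z = starlike_quotient f z" if z: "z \<in> \<bbbD>" for z
  proof (cases "z = 0")
    case True
    then show ?thesis by (simp add: starlike_quotient_def)
  next
    case False
    have dh: "(h has_field_derivative deriv h z) (at z)"
      using holomorphic_derivI[OF h open_ball z] .
    have "((\<lambda>z. z * h z) has_field_derivative (h z + z * deriv h z)) (at z)"
      by (rule derivative_eq_intros dh refl | simp)+
    then have "(f has_field_derivative (h z + z * deriv h z)) (at z)"
      by (rule has_field_derivative_transform_within_open[OF _ open_ball z]) (use fh in auto)
    then have "deriv f z = h z + z * deriv h z"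
      by (rule DERIV_imp_deriv)
    then show ?thesis
      using False hnz[OF z] fh[of z] z by (simp add: starlike_quotient_def field_simps)
  qed
  have "(\<lambda>z. 1 + z * deriv h z / h z) holomorphic_on \<bbbD>"
    using hnz by (intro holomorphic_intros holomorphic_deriv h) auto
  then show ?thesis
    using eq by (rule holomorphic_transform)
qed

text \<open>The Moebius map \<open>w = (p - 1) / (p + 1 - 2 \<alpha>)\<close> carries the half-plane
  Re > \<alpha> to the unit disk and 1 to 0, so the Schwarz lemma gives
  \<open>cmod (w z) \<le> t\<close>. Solved for \<open>p z\<close>, this inequality describes an
  Apollonius disc.\<close>

lemma Re_gt_disc:
  assumes p: "p holomorphic_on \<bbbD>" and p0: "p 0 = 1" and \<alpha>: "\<alpha> < 1"
    and re: "\<And>z. z \<in> \<bbbD> \<Longrightarrow> Re (p z) > \<alpha>" and z: "z \<in> \<bbbD>"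
  defines "t \<equiv> cmod z"
  shows "cmod (p z - of_real ((1 + (1 - 2 * \<alpha>) * t\<^sup>2) / (1 - t\<^sup>2))) \<le> 2 * (1 - \<alpha>) * t / (1 - t\<^sup>2)"
proof -
  define w where "w = (\<lambda>z. (p z - 1) / (p z + 1 - 2 * of_real \<alpha>))"
  have nz: "p z + 1 - 2 * of_real \<alpha> \<noteq> 0" if "z \<in> \<bbbD>" for z
  proof
    assume "p z + 1 - 2 * of_real \<alpha> = 0"
    then have "Re (p z) + 1 - 2 * \<alpha> = 0" by (simp add: complex_eq_iff)
    with re[OF that] \<alpha> show False by simp
  qed
  have hw: "w holomorphic_on ball 0 1"
    unfolding w_def using nz by (intro holomorphic_intros p) auto
  have w1: "cmod (w z) < 1" if "norm z < 1" for z
  proof -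
    have zD: "z \<in> \<bbbD>" using that by simp
    \<comment> \<open>The right side exceeds the left by 4 (Re p - \<alpha>) (1 - \<alpha>).\<close>
    have "(cmod (p z - 1))\<^sup>2 < (cmod (p z + 1 - 2 * of_real \<alpha>))\<^sup>2"
    proof -
      have "0 < (Re (p z) - \<alpha>) * (1 - \<alpha>)"
        using re[OF zD] \<alpha> by (intro mult_pos_pos) auto
      then show ?thesis
        unfolding cmod_power2 by (simp add: power2_eq_square algebra_simps)
    qed
    then have "cmod (p z - 1) < cmod (p z + 1 - 2 * of_real \<alpha>)"
      by (simp add: power2_less_imp_less)
    then show ?thesis
      using nz[OF zD] by (simp add: w_def norm_divide)
  qed
  have "cmod (w z) \<le> cmod z"
    using Schwarz_Lemma(1)[OF hw _ w1] z p0 by (simp add: w_def)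
  then have "cmod (p z - 1) \<le> t * cmod (p z + 1 - 2 * of_real \<alpha>)"
    using nz[OF z] by (simp add: w_def norm_divide field_simps t_def)
  then have "(cmod (p z - 1))\<^sup>2 \<le> (t * cmod (p z + 1 - 2 * of_real \<alpha>))\<^sup>2"
    by (intro power_mono) auto
  then have *: "(cmod (p z - 1))\<^sup>2 \<le> t\<^sup>2 * (cmod (p z + 1 - 2 * of_real \<alpha>))\<^sup>2"
    by (simp add: power_mult_distrib)
  have t: "0 \<le> t" "t < 1" using z by (auto simp: t_def)
  then have s: "0 < 1 - t\<^sup>2" by (simp add: power_less_one_iff)
  define x y where "x = Re (p z)" and "y = Im (p z)"
  define c where "c = 1 + (1 - 2 * \<alpha>) * t\<^sup>2"
  have "(x - 1)\<^sup>2 + y\<^sup>2 \<le> t\<^sup>2 * ((x + 1 - 2 * \<alpha>)\<^sup>2 + y\<^sup>2)"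
    using * by (simp add: cmod_power2 x_def y_def)
  \<comment> \<open>Multiplying by 1 - t^2, the coefficient of x^2 and y^2 after collecting terms,
    completes the square without division.\<close>
  then have "0 \<le> (1 - t\<^sup>2) * (t\<^sup>2 * ((x + 1 - 2 * \<alpha>)\<^sup>2 + y\<^sup>2) - ((x - 1)\<^sup>2 + y\<^sup>2))"
    using s by simp
  also have "\<dots> = (2 * (1 - \<alpha>) * t)\<^sup>2 - (((1 - t\<^sup>2) * x - c)\<^sup>2 + ((1 - t\<^sup>2) * y)\<^sup>2)"
    unfolding c_def by algebra
  finally have "(cmod (of_real (1 - t\<^sup>2) * p z - of_real c))\<^sup>2 \<le> (2 * (1 - \<alpha>) * t)\<^sup>2"
    unfolding cmod_power2 x_def y_def by simp
  then have "cmod (of_real (1 - t\<^sup>2) * p z - of_real c) \<le> 2 * (1 - \<alpha>) * t"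
    by (rule power2_le_imp_le) (use t \<alpha> in simp)
  moreover have "of_real (1 - t\<^sup>2) * p z - of_real c = of_real (1 - t\<^sup>2) * (p z - of_real (c / (1 - t\<^sup>2)))"
  proof -
    have "of_real c = (of_real (1 - t\<^sup>2) * of_real (c / (1 - t\<^sup>2)) :: complex)"
      unfolding of_real_mult[symmetric] using s by simp
    then show ?thesis by (simp only: right_diff_distrib)
  qed
  ultimately have "(1 - t\<^sup>2) * cmod (p z - of_real (c / (1 - t\<^sup>2))) \<le> 2 * (1 - \<alpha>) * t"
    using s by (simp only: norm_mult norm_of_real)
  then show ?thesis
    using s by (simp add: c_def pos_le_divide_eq mult.commute)
qed

text \<open>Induction on the degree, splitting off one root x at a time. Since x has modulus at
  least 1, the summand \<open>z / (z - x)\<close> lies in the disc with centre -t^2 / (1 - t^2) and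
  radius t / (1 - t^2); summing discs adds centres and radii.\<close>

lemma poly_log_deriv_disc:
  fixes Q :: "complex poly"
  assumes "Q \<noteq> 0" and "\<And>x. poly Q x = 0 \<Longrightarrow> 1 \<le> cmod x" and "cmod z < 1"
  defines "t \<equiv> cmod z"
  shows "cmod (z * poly (pderiv Q) z / poly Q z + of_real (real (degree Q) * (t\<^sup>2 / (1 - t\<^sup>2))))
           \<le> real (degree Q) * (t / (1 - t\<^sup>2))"
  using assms(1,2)
proof (induction "degree Q" arbitrary: Q)
  case 0
  then have "pderiv Q = 0" by (simp add: pderiv_eq_0_iff)
  with 0 show ?case by simp
next
  case (Suc n)
  have s: "0 < 1 - t\<^sup>2" using assms(3) by (simp add: power_less_one_iff t_def)
  obtain x where x: "poly Q x = 0"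
    using alg_closed_imp_poly_has_root[of Q] Suc.hyps(2) by auto
  then obtain P where Q: "Q = [:-x, 1:] * P"
    by (metis dvdE poly_eq_0_iff_dvd)
  have P0: "P \<noteq> 0" using Suc.prems(1) Q by auto
  have dQ: "degree Q = Suc (degree P)"
    unfolding Q using P0 by (subst degree_mult_eq) auto
  have x1: "1 \<le> cmod x" using Suc.prems(2) x by simp
  have IH: "cmod (z * poly (pderiv P) z / poly P z + of_real (real (degree P) * (t\<^sup>2 / (1 - t\<^sup>2))))
           \<le> real (degree P) * (t / (1 - t\<^sup>2))"
    using Suc.hyps dQ P0 Suc.prems(2) by (intro Suc.hyps(1)) (auto simp: Q)
  have nzP: "poly P z \<noteq> 0"
    using Suc.prems(2)[of z] assms(3) by (auto simp: Q)
  have nzx: "z - x \<noteq> 0" using x1 assms(3) by auto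
  have split: "z * poly (pderiv Q) z / poly Q z = z / (z - x) + z * poly (pderiv P) z / poly P z"
  proof -
    have "poly (pderiv Q) z = (z - x) * poly (pderiv P) z + poly P z"
      unfolding Q pderiv_mult by (simp add: pderiv_pCons algebra_simps)
    moreover have "poly Q z = (z - x) * poly P z"
      by (simp add: Q algebra_simps)
    ultimately show ?thesis
      using nzP nzx by (simp add: add_divide_distrib distrib_left)
  qed
  \<comment> \<open>The disc condition for one root, cleared of denominators: the right side exceeds
    the left by t^2 (1 - t^2) (|x|^2 - 1).\<close>
  have "(cmod (z - of_real (t\<^sup>2) * x))\<^sup>2 \<le> (t * cmod (z - x))\<^sup>2"
  proof -
    have tt: "t\<^sup>2 = (Re z)\<^sup>2 + (Im z)\<^sup>2" by (simp add: t_def cmod_power2)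
    have "0 \<le> t\<^sup>2 * (1 - t\<^sup>2) * ((cmod x)\<^sup>2 - 1)"
      using s x1 by (intro mult_nonneg_nonneg) auto
    also have "(cmod x)\<^sup>2 = (Re x)\<^sup>2 + (Im x)\<^sup>2" by (rule cmod_power2)
    also have "t\<^sup>2 * (1 - t\<^sup>2) * ((Re x)\<^sup>2 + (Im x)\<^sup>2 - 1) =
        t\<^sup>2 * ((Re z - Re x)\<^sup>2 + (Im z - Im x)\<^sup>2) - ((Re z - t\<^sup>2 * Re x)\<^sup>2 + (Im z - t\<^sup>2 * Im x)\<^sup>2)"
      using tt by algebra
    finally show ?thesis
      unfolding power_mult_distrib cmod_power2 by simp
  qed
  then have "cmod (z - of_real (t\<^sup>2) * x) \<le> t * cmod (z - x)"
    by (rule power2_le_imp_le) (simp add: t_def)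
  then have "cmod (z - of_real (t\<^sup>2) * x) / ((1 - t\<^sup>2) * cmod (z - x))
      \<le> t * cmod (z - x) / ((1 - t\<^sup>2) * cmod (z - x))"
    using s by (intro divide_right_mono) auto
  moreover have "z / (z - x) + of_real (t\<^sup>2 / (1 - t\<^sup>2))
      = (z - of_real (t\<^sup>2) * x) / (of_real (1 - t\<^sup>2) * (z - x))"
  proof -
    have "of_real (1 - t\<^sup>2) \<noteq> (0::complex)" using s by (simp only: of_real_eq_0_iff)
    then show ?thesis
      using nzx by (simp add: divide_simps) (simp add: algebra_simps)
  qed
  moreover have "cmod (of_real (1 - t\<^sup>2) * (z - x)) = (1 - t\<^sup>2) * cmod (z - x)"
    unfolding norm_mult norm_of_real using s by simp
  ultimately have disc: "cmod (z / (z - x) + of_real (t\<^sup>2 / (1 - t\<^sup>2))) \<le> t / (1 - t\<^sup>2)"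
    using nzx by (simp only: norm_divide) simp
  from norm_triangle_mono[OF disc IH] show ?case
    unfolding split dQ by (simp add: algebra_simps add_divide_distrib)
qed

section \<open>Logarithmic derivatives of powers, products and dilations\<close>

text \<open>Differentiating \<open>exp (L z) = poly Q z\<close> gives L' = Q'/Q, so the derivative
  of the branch is expressed without the chosen logarithm.\<close>

lemma power_branch_log_deriv:
  assumes "is_power_branch (poly Q) c g"
  shows "g 0 = 1" and "g holomorphic_on \<bbbD>"
    and "\<And>z. z \<in> \<bbbD> \<Longrightarrow> g z \<noteq> 0"
    and "\<And>z. z \<in> \<bbbD> \<Longrightarrow> deriv g z = of_real c * (poly (pderiv Q) z / poly Q z) * g z"
proof -
  from assms obtain L where L: "L holomorphic_on \<bbbD>"
    and eL: "\<And>z. z \<in> \<bbbD> \<Longrightarrow> exp (L z) = poly Q z"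
    and g: "\<And>z. z \<in> \<bbbD> \<Longrightarrow> g z = exp (of_real c * L z)"
    unfolding is_power_branch_def by blast
  show "g 0 = 1" using assms by (simp add: is_power_branch_def)
  show "g z \<noteq> 0" if "z \<in> \<bbbD>" for z using g[OF that] by simp
  have "(\<lambda>z. exp (of_real c * L z)) holomorphic_on \<bbbD>"
    by (intro holomorphic_intros L)
  then show "g holomorphic_on \<bbbD>"
    by (rule holomorphic_transform) (simp add: g)
  fix z assume z: "z \<in> \<bbbD>"
  have dL: "(L has_field_derivative deriv L z) (at z)"
    using holomorphic_derivI[OF L open_ball z] .
  have "((\<lambda>z. exp (L z)) has_field_derivative exp (L z) * deriv L z) (at z)"
    by (rule derivative_eq_intros dL refl | simp)+
  then have "(poly Q has_field_derivative exp (L z) * deriv L z) (at z)"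
    by (rule has_field_derivative_transform_within_open[OF _ open_ball z]) (use eL in auto)
  then have "poly (pderiv Q) z = exp (L z) * deriv L z"
    using poly_DERIV DERIV_unique by blast
  then have "poly (pderiv Q) z / poly Q z = deriv L z"
    using eL[OF z] by (metis exp_not_eq_zero nonzero_mult_div_cancel_left)
  moreover have "((\<lambda>z. exp (of_real c * L z)) has_field_derivative
      exp (of_real c * L z) * (of_real c * deriv L z)) (at z)"
    by (rule derivative_eq_intros dL refl | simp)+
  then have "(g has_field_derivative exp (of_real c * L z) * (of_real c * deriv L z)) (at z)"
    by (rule has_field_derivative_transform_within_open[OF _ open_ball z]) (use g in auto)
  then have "deriv g z = exp (of_real c * L z) * (of_real c * deriv L z)"
    by (rule DERIV_imp_deriv)
  ultimately show "deriv g z = of_real c * (poly (pderiv Q) z / poly Q z) * g z"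
    using g[OF z] by simp
qed

lemma starlike_quotient_product:
  assumes f: "f \<in> class_A" "\<forall>z\<in>\<bbbD> - {0}. f z \<noteq> 0"
    and g: "is_power_branch (poly Q) c g"
    and F: "\<forall>z\<in>\<bbbD>. F z = f z * g z"
  shows "F \<in> class_A" and "\<forall>z\<in>\<bbbD> - {0}. F z \<noteq> 0"
    and "\<And>z. z \<in> \<bbbD> \<Longrightarrow>
      starlike_quotient F z = starlike_quotient f z + of_real c * (z * poly (pderiv Q) z / poly Q z)"
proof -
  note g = power_branch_log_deriv[OF g]
  have hf: "f holomorphic_on \<bbbD>" and f0: "f 0 = 0" "deriv f 0 = 1"
    using f(1) by (auto simp: class_A_def)
  have dF: "deriv F z = deriv f z * g z + f z * deriv g z" if z: "z \<in> \<bbbD>" for z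
  proof -
    have "((\<lambda>z. f z * g z) has_field_derivative (deriv f z * g z + f z * deriv g z)) (at z)"
      by (rule derivative_eq_intros holomorphic_derivI[OF hf open_ball z]
          holomorphic_derivI[OF g(2) open_ball z] refl | simp)+
    then have "(F has_field_derivative (deriv f z * g z + f z * deriv g z)) (at z)"
      by (rule has_field_derivative_transform_within_open[OF _ open_ball z]) (use F in auto)
    then show ?thesis by (rule DERIV_imp_deriv)
  qed
  have "(\<lambda>z. f z * g z) holomorphic_on \<bbbD>"
    by (intro holomorphic_intros hf g)
  then have "F holomorphic_on \<bbbD>"
    by (rule holomorphic_transform) (simp add: F)
  then show "F \<in> class_A"
    using F dF[of 0] f0 g(1) by (simp add: class_A_def)
  show "\<forall>z\<in>\<bbbD> - {0}. F z \<noteq> 0"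
    using F f(2) g(3) by auto
  show "starlike_quotient F z = starlike_quotient f z + of_real c * (z * poly (pderiv Q) z / poly Q z)"
    if z: "z \<in> \<bbbD>" for z
  proof (cases "z = 0")
    case True
    then show ?thesis by (simp add: starlike_quotient_def)
  next
    case False
    then have nz: "f z \<noteq> 0" "g z \<noteq> 0" using f(2) g(3)[of z] z by auto
    have "starlike_quotient F z = z * (deriv f z * g z + f z * deriv g z) / (f z * g z)"
      using False z by (simp add: starlike_quotient_def dF F)
    also have "\<dots> = z * deriv f z / f z + z * (deriv g z / g z)"
      using nz by (simp add: field_simps)
    also have "deriv g z / g z = of_real c * (poly (pderiv Q) z / poly Q z)"
      using nz z by (simp add: g(4))
    finally show ?thesis using False by (simp add: starlike_quotient_def)
  qed
qed

text \<open>The disc for z Q'/Q has centre and radius proportional to the degree n, which the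
  exponent \<beta>/n cancels. Adding the half-plane disc of \<open>f\<close> gives a bound
  independent of n.\<close>

lemma product_family_disc:
  assumes "F \<in> product_family \<alpha> \<beta> n" and "\<alpha> < 1" and "\<beta> > 0" and "n \<ge> 1"
  shows "F \<in> class_A" and "\<forall>z\<in>\<bbbD> - {0}. F z \<noteq> 0"
    and "\<And>z. z \<in> \<bbbD> \<Longrightarrow>
      cmod (starlike_quotient F z
            - of_real ((1 + (1 - 2 * \<alpha> - \<beta>) * (cmod z)\<^sup>2) / (1 - (cmod z)\<^sup>2)))
        \<le> (2 - 2 * \<alpha> + \<beta>) * cmod z / (1 - (cmod z)\<^sup>2)"
proof -
  from assms(1) obtain f Q g where f: "f \<in> starlike_of_order \<alpha>"
    and Q: "degree Q = n" "poly Q 0 = 1" "\<And>z. poly Q z = 0 \<Longrightarrow> z \<notin> \<bbbD>"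
    and g: "is_power_branch (poly Q) (\<beta> / real n) g"
    and F: "\<forall>z\<in>\<bbbD>. F z = f z * g z"
    unfolding product_family_def by blast
  have fA: "f \<in> class_A" and fnz: "\<forall>z\<in>\<bbbD> - {0}. f z \<noteq> 0"
    and fre: "\<And>z. z \<in> \<bbbD> \<Longrightarrow> Re (starlike_quotient f z) > \<alpha>"
    using f by (auto simp: starlike_of_order_def)
  note prod = starlike_quotient_product[OF fA fnz g F]
  show "F \<in> class_A" "\<forall>z\<in>\<bbbD> - {0}. F z \<noteq> 0"
    by (rule prod)+
  fix z assume z: "z \<in> \<bbbD>"
  define t where "t = cmod z"
  have n: "real n > 0" using assms by simp
  have "0 < 1 - t\<^sup>2" using z by (simp add: power_less_one_iff t_def)
  define s where "s = 1 - t\<^sup>2"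
  have s: "s > 0" using \<open>0 < 1 - t\<^sup>2\<close> by (simp add: s_def)
  define p where "p = starlike_quotient f z"
  define k where "k = z * poly (pderiv Q) z / poly Q z"
  have 1: "cmod (p - of_real ((1 + (1 - 2 * \<alpha>) * t\<^sup>2) / s)) \<le> 2 * (1 - \<alpha>) * t / s"
    unfolding t_def p_def s_def
    by (intro Re_gt_disc holomorphic_starlike_quotient fA fnz fre z assms)
       (auto simp: starlike_quotient_def)
  have "cmod (k + of_real (real n * (t\<^sup>2 / s))) \<le> real n * (t / s)"
    unfolding t_def k_def s_def Q(1)[symmetric] using Q z
    by (intro poly_log_deriv_disc) (auto simp: not_less)
  then have "(\<beta> / real n) * cmod (k + of_real (real n * (t\<^sup>2 / s))) \<le> (\<beta> / real n) * (real n * (t / s))"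
    using assms by (intro mult_left_mono) auto
  moreover have "(\<beta> / real n) * cmod (k + of_real (real n * (t\<^sup>2 / s)))
      = cmod (of_real (\<beta> / real n) * (k + of_real (real n * (t\<^sup>2 / s))))"
    unfolding norm_mult norm_of_real using assms by simp
  ultimately have 2: "cmod (of_real (\<beta> / real n) * (k + of_real (real n * (t\<^sup>2 / s)))) \<le> \<beta> * t / s"
    using n by simp
  have eq: "of_real ((1 + (1 - 2 * \<alpha> - \<beta>) * t\<^sup>2) / s) =
     (of_real ((1 + (1 - 2 * \<alpha>) * t\<^sup>2) / s) - of_real (\<beta> / real n) * of_real (real n * (t\<^sup>2 / s)) :: complex)"
    unfolding of_real_mult[symmetric] of_real_diff[symmetric] of_real_eq_iff
    using n s by (simp add: field_simps)
  have "starlike_quotient F z - of_real ((1 + (1 - 2 * \<alpha> - \<beta>) * t\<^sup>2) / s)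
      = (p - of_real ((1 + (1 - 2 * \<alpha>) * t\<^sup>2) / s))
        + of_real (\<beta> / real n) * (k + of_real (real n * (t\<^sup>2 / s)))"
    unfolding prod(3)[OF z] p_def[symmetric] k_def[symmetric] eq
    by (simp add: algebra_simps)
  also have "cmod \<dots> \<le> 2 * (1 - \<alpha>) * t / s + \<beta> * t / s"
    using norm_triangle_mono[OF 1 2] .
  also have "\<dots> = (2 - 2 * \<alpha> + \<beta>) * t / s"
    by (simp add: add_divide_distrib[symmetric] algebra_simps)
  finally show "cmod (starlike_quotient F z
            - of_real ((1 + (1 - 2 * \<alpha> - \<beta>) * (cmod z)\<^sup>2) / (1 - (cmod z)\<^sup>2)))
        \<le> (2 - 2 * \<alpha> + \<beta>) * cmod z / (1 - (cmod z)\<^sup>2)"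
    by (simp add: t_def s_def)
qed

text \<open>Reduces statements about the dilated function to values of the quotient of
  \<open>F\<close> on the disk of radius r.\<close>

lemma class_A_dilation:
  assumes F: "F \<in> class_A" "\<forall>z\<in>\<bbbD> - {0}. F z \<noteq> 0" and r: "0 < r" "r < 1"
  defines "G \<equiv> \<lambda>z. F (of_real r * z) / of_real r"
  shows "G \<in> class_A" and "\<forall>z\<in>\<bbbD> - {0}. G z \<noteq> 0"
    and "\<And>z. z \<in> \<bbbD> \<Longrightarrow> starlike_quotient G z = starlike_quotient F (of_real r * z)"
proof -
  have hF: "F holomorphic_on \<bbbD>" and F0: "F 0 = 0" "deriv F 0 = 1"
    using F(1) by (auto simp: class_A_def)
  have D: "of_real r * z \<in> \<bbbD>" if "z \<in> \<bbbD>" for z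
  proof -
    have "r * cmod z \<le> 1 * cmod z" using r by (intro mult_right_mono) auto
    then show ?thesis using that r by (simp add: norm_mult)
  qed
  have dG: "(G has_field_derivative deriv F (of_real r * z)) (at z)" if z: "z \<in> \<bbbD>" for z
  proof -
    have "((\<lambda>z. F (of_real r * z)) has_field_derivative deriv F (of_real r * z) * of_real r) (at z)"
      by (rule DERIV_chain2[of F "deriv F (of_real r * z)" "\<lambda>z. of_real r * z"])
         (auto intro!: holomorphic_derivI[OF hF open_ball D[OF z]] derivative_eq_intros)
    from DERIV_cdivide[OF this, of "of_real r"] show ?thesis
      using r by (simp add: G_def)
  qed
  have "G holomorphic_on \<bbbD>"
    unfolding holomorphic_on_open[OF open_ball] using dG by blast
  then show "G \<in> class_A"
    using DERIV_imp_deriv[OF dG[of 0]] F0 by (simp add: class_A_def G_def)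
  show "\<forall>z\<in>\<bbbD> - {0}. G z \<noteq> 0"
    using F(2) D r by (auto simp: G_def)
  show "starlike_quotient G z = starlike_quotient F (of_real r * z)" if "z \<in> \<bbbD>" for z
    using DERIV_imp_deriv[OF dG[OF that]] r by (auto simp: starlike_quotient_def G_def)
qed

section \<open>Subordination to a univalent map, and the geometry of the nephroid\<close>

lemma subordinate_if_avoids_boundary:
  assumes h: "h holomorphic_on \<bbbD>" "continuous_on (cball 0 1) h" "inj_on h \<bbbD>"
    and q: "q holomorphic_on \<bbbD>" "q 0 = h 0" "q ` \<bbbD> \<inter> h ` sphere 0 1 = {}"
  shows "q \<prec>\<^sub>D h"
proof -
  have op: "open (h ` \<bbbD>)"
    using open_mapping_thm3[OF h(1) open_ball h(3)] .
  have cl: "closed (h ` cball 0 1)"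
    by (intro compact_imp_closed compact_continuous_image h compact_cball)
  have con: "connected (q ` \<bbbD>)"
    by (intro connected_continuous_image holomorphic_on_imp_continuous_on q connected_ball)
  have sub: "h ` \<bbbD> \<inter> - (h ` cball 0 1) \<inter> q ` \<bbbD> = {}"
    by fastforce
  have cov: "q ` \<bbbD> \<subseteq> h ` \<bbbD> \<union> - (h ` cball 0 1)"
  proof -
    have "h ` cball 0 1 = h ` \<bbbD> \<union> h ` sphere 0 1"
      unfolding image_Un[symmetric] by (rule arg_cong[of _ _ "(`) h"]) auto
    then show ?thesis using q(3) by blast
  qed
  have ne: "h ` \<bbbD> \<inter> q ` \<bbbD> \<noteq> {}"
  proof -
    have "q 0 \<in> q ` \<bbbD>" by (rule imageI) simp
    moreover have "q 0 \<in> h ` \<bbbD>" unfolding q(2) by (rule imageI) simp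
    ultimately show ?thesis by blast
  qed
  have "- (h ` cball 0 1) \<inter> q ` \<bbbD> = {}"
    using connectedD[OF con op _ sub cov] cl ne by (auto simp: open_Compl)
  with cov have qh: "q ` \<bbbD> \<subseteq> h ` \<bbbD>" by blast
  obtain k where k: "k holomorphic_on h ` \<bbbD>" "\<And>z. z \<in> \<bbbD> \<Longrightarrow> k (h z) = z"
    using holomorphic_has_inverse[OF h(1) open_ball h(3)] by metis
  have "(k \<circ> q) holomorphic_on \<bbbD>"
    by (rule holomorphic_on_compose_gen[OF q(1) k(1) qh])
  moreover have "(k \<circ> q) ` \<bbbD> \<subseteq> \<bbbD>"
    using qh k(2) by (force simp: image_subset_iff image_iff)
  moreover have "(k \<circ> q) 0 = 0"
    using q(2) k(2)[of 0] by simp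
  moreover have "\<forall>z\<in>\<bbbD>. q z = h ((k \<circ> q) z)"
    using qh k(2) by (force simp: image_subset_iff image_iff)
  ultimately show ?thesis
    unfolding subordinate_def using h(1) q(1) by blast
qed

lemma holomorphic_nephroid_map: "nephroid_map holomorphic_on A"
  unfolding nephroid_map_def by (intro holomorphic_intros) auto

text \<open>The difference of two values factors as (z - w) (3 - (z^2 + z w + w^2)) / 3, and each of
  the three products has modulus below 1.\<close>

lemma inj_on_nephroid_map: "inj_on nephroid_map \<bbbD>"
proof (rule inj_onI)
  fix z w assume zw: "z \<in> \<bbbD>" "w \<in> \<bbbD>" and eq: "nephroid_map z = nephroid_map w"
  have "(z - w) * (3 - (z * z + z * w + w * w)) = 3 * (nephroid_map z - nephroid_map w)"
    by (simp add: nephroid_map_def power3_eq_cube algebra_simps)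
  then have "(z - w) * (3 - (z * z + z * w + w * w)) = 0"
    using eq by simp
  moreover have "3 - (z * z + z * w + w * w) \<noteq> 0"
  proof
    assume "3 - (z * z + z * w + w * w) = 0"
    then have "cmod (z * z + z * w + w * w) = 3" by simp
    moreover have "cmod (z * z) < 1" "cmod (z * w) < 1" "cmod (w * w) < 1"
      using zw mult_strict_mono[of "cmod z" 1 "cmod z" 1] mult_strict_mono[of "cmod z" 1 "cmod w" 1]
        mult_strict_mono[of "cmod w" 1 "cmod w" 1] by (auto simp: norm_mult)
    ultimately show False
      using norm_triangle_ineq[of "z * z + z * w" "w * w"] norm_triangle_ineq[of "z * z" "z * w"]
      by linarith
  qed
  ultimately show "z = w" by simp
qed

lemma real_value_nephroid_map:
  assumes "w \<in> \<bbbD>" and "nephroid_map w = of_real x"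
  shows "1 / 3 < x" and "x < 5 / 3"
proof -
  define u v where "u = Re w" and "v = Im w"
  have uv: "u\<^sup>2 + v\<^sup>2 < 1"
    using assms(1) abs_square_less_1[of "cmod w"] by (simp add: cmod_power2 u_def v_def)
  have re: "1 + u - (u ^ 3 - 3 * u * v\<^sup>2) / 3 = x" and im: "v - (3 * u\<^sup>2 * v - v ^ 3) / 3 = 0"
    using arg_cong[OF assms(2), of Re] arg_cong[OF assms(2), of Im]
    by (simp_all add: nephroid_map_def u_def v_def power3_eq_cube power2_eq_square algebra_simps)
  \<comment> \<open>A real value forces a real argument: the imaginary part is v times a factor that
    is positive on the disk.\<close>
  have "v * (1 - u\<^sup>2 + v\<^sup>2 / 3) = 0"
    using im by (simp add: power3_eq_cube power2_eq_square algebra_simps)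
  moreover have "1 - u\<^sup>2 + v\<^sup>2 / 3 > 0" using uv zero_le_power2[of v] by linarith
  ultimately have v: "v = 0" by simp
  with uv have "\<bar>u\<bar> < 1" using abs_square_less_1[of u] by simp
  then have u: "-1 < u" "u < 1" by auto
  have x: "x = 1 + u - u ^ 3 / 3" using re v by simp
  \<comment> \<open>The cubic has critical points at -1 and 1, the preimages of the cusps 1/3 and
    5/3; hence the double factors.\<close>
  have "x - 1 / 3 = (1 + u)\<^sup>2 * (2 - u) / 3" "5 / 3 - x = (1 - u)\<^sup>2 * (2 + u) / 3"
    unfolding x by (simp_all add: power3_eq_cube power2_eq_square algebra_simps)
  moreover have "(1 + u)\<^sup>2 * (2 - u) / 3 > 0" "(1 - u)\<^sup>2 * (2 + u) / 3 > 0"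
    using u by auto
  ultimately show "1 / 3 < x" "x < 5 / 3" by linarith+
qed

text \<open>On the unit circle the squared distance is a polynomial in \<open>c = Re u\<close>; subtracting its value at
  the nearer cusp \<open>u = \<plusminus>1\<close> leaves a nonnegative remainder.\<close>

lemma dist_nephroid_curve:
  assumes u: "cmod u = 1" and a: "1 / 3 \<le> a" "a \<le> 5 / 3"
  shows "min (a - 1 / 3) (5 / 3 - a) \<le> cmod (nephroid_map u - of_real a)"
proof -
  define c d s where "c = Re u" and "d = Im u" and "s = 1 - a"
  have cd: "c\<^sup>2 + d\<^sup>2 = 1" using u by (metis cmod_power2 c_def d_def one_power2)
  have c1: "-1 \<le> c" "c \<le> 1" using abs_Re_le_cmod[of u] u by (auto simp: c_def)
  then have c2: "c\<^sup>2 \<le> 1" by (simp add: abs_square_le_1)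
  have "(cmod (nephroid_map u - of_real a))\<^sup>2
      = (s + c - (c ^ 3 - 3 * c * d\<^sup>2) / 3)\<^sup>2 + (d - (3 * c\<^sup>2 * d - d ^ 3) / 3)\<^sup>2"
  proof -
    have "Re (nephroid_map u - of_real a) = s + c - (c ^ 3 - 3 * c * d\<^sup>2) / 3"
      "Im (nephroid_map u - of_real a) = d - (3 * c\<^sup>2 * d - d ^ 3) / 3"
      by (simp_all add: nephroid_map_def c_def d_def s_def power3_eq_cube power2_eq_square algebra_simps)
    then show ?thesis unfolding cmod_power2 by simp
  qed
  also have "\<dots> = (2 / 3 - s)\<^sup>2 + 4 / 3 * (1 + c) * ((1 - c) + s * (1 + 2 * c - 2 * c\<^sup>2))"
  proof -
    \<comment> \<open>Scaling by 9 clears the denominators, leaving a polynomial identity modulo c^2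
      + d^2 = 1.\<close>
    have scale: "9 * ((x - y / 3)\<^sup>2 + (v - w / 3)\<^sup>2) = (3 * x - y)\<^sup>2 + (3 * v - w)\<^sup>2"
      for x y v w :: real
      by (simp add: power2_eq_square field_simps)
    have "9 * ((s + c - (c ^ 3 - 3 * c * d\<^sup>2) / 3)\<^sup>2 + (d - (3 * c\<^sup>2 * d - d ^ 3) / 3)\<^sup>2)
       = (3 * (s + c) - (c ^ 3 - 3 * c * d\<^sup>2))\<^sup>2 + (3 * d - (3 * c\<^sup>2 * d - d ^ 3))\<^sup>2"
      by (rule scale)
    also have "\<dots> = (2 - 3 * s)\<^sup>2 + 12 * (1 + c) * ((1 - c) + s * (1 + 2 * c - 2 * c\<^sup>2))"
      using cd by algebra
    also have "\<dots> = 9 * ((2 / 3 - s)\<^sup>2 + 4 / 3 * (1 + c) * ((1 - c) + s * (1 + 2 * c - 2 * c\<^sup>2)))"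
      by (simp add: power2_eq_square field_simps)
    finally show ?thesis by simp
  qed
  finally have sq: "(cmod (nephroid_map u - of_real a))\<^sup>2
      = (2 / 3 - s)\<^sup>2 + 4 / 3 * (1 + c) * ((1 - c) + s * (1 + 2 * c - 2 * c\<^sup>2))" .
  show ?thesis
  proof (cases "s \<ge> 0")
    case True
    \<comment> \<open>Each summand is nonnegative for 0 \<le> s \<le> 2/3 and -1 \<le> c \<le>
      1.\<close>
    have "(1 - c) + s * (1 + 2 * c - 2 * c\<^sup>2) = (1 - c) * (2 - 3 * s) / 2 + (1 + c) * s / 2 + 2 * s * (1 - c\<^sup>2)"
      by (simp add: power2_eq_square field_simps)
    also have "\<dots> \<ge> 0"
    proof -
      have "0 \<le> (1 - c) * (2 - 3 * s)" "0 \<le> (1 + c) * s" "0 \<le> 2 * s * (1 - c\<^sup>2)"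
        using True a(1) c1 c2 by (intro mult_nonneg_nonneg; simp add: s_def)+
      then show ?thesis by linarith
    qed
    finally have "(2 / 3 - s)\<^sup>2 \<le> (cmod (nephroid_map u - of_real a))\<^sup>2"
      unfolding sq using c1 by simp
    then have "2 / 3 - s \<le> cmod (nephroid_map u - of_real a)"
      by (rule power2_le_imp_le) simp
    then show ?thesis by (simp add: s_def)
  next
    case False
    \<comment> \<open>The same polynomial re-expanded at the other cusp c = 1, which is the nearer
      one when a > 1; this is the mirror image under (c, s) -> (-c, -s).\<close>
    have eq: "(2 / 3 - s)\<^sup>2 + 4 / 3 * (1 + c) * ((1 - c) + s * (1 + 2 * c - 2 * c\<^sup>2))
      = (2 / 3 + s)\<^sup>2 + 4 / 3 * (1 - c) * ((1 + c) - s * (1 - 2 * c - 2 * c\<^sup>2))"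
      by algebra
    have "(1 + c) - s * (1 - 2 * c - 2 * c\<^sup>2) = (1 + c) * (2 + 3 * s) / 2 + (1 - c) * (- s) / 2 + 2 * (- s) * (1 - c\<^sup>2)"
      by (simp add: power2_eq_square field_simps)
    also have "\<dots> \<ge> 0"
    proof -
      have "0 \<le> (1 + c) * (2 + 3 * s)" "0 \<le> (1 - c) * (- s)" "0 \<le> 2 * (- s) * (1 - c\<^sup>2)"
        using False a(2) c1 c2 by (intro mult_nonneg_nonneg; simp add: s_def)+
      then show ?thesis by linarith
    qed
    finally have "(2 / 3 + s)\<^sup>2 \<le> (cmod (nephroid_map u - of_real a))\<^sup>2"
      unfolding sq eq using c1 by simp
    then have "2 / 3 + s \<le> cmod (nephroid_map u - of_real a)"
      by (rule power2_le_imp_le) simp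
    then show ?thesis by (simp add: s_def)
  qed
qed

section \<open>The quadratic for the radius, and sufficiency\<close>

text \<open>\<open>\<rho>\<close> is a root in rationalised form, which also covers B = 0. With S
  the root of the discriminant, the quadratic is (4 - (3K + S) r) (4 - (3K - S) r) / 8; the first
  factor changes sign at \<open>\<rho>\<close> and the second stays positive on [0, 1).\<close>

lemma quadratic_root_sign:
  fixes K B :: real
  assumes K: "K > 0" and neg: "2 - 3 * K + B < 0"
  defines "\<rho> \<equiv> 4 / (3 * K + sqrt (9 * K\<^sup>2 - 8 * B))"
  shows "0 < \<rho>" and "\<rho> < 1"
    and "\<And>r. 0 \<le> r \<Longrightarrow> r < \<rho> \<Longrightarrow> 2 - 3 * K * r + B * r\<^sup>2 > 0"
    and "\<And>r. \<rho> < r \<Longrightarrow> r < 1 \<Longrightarrow> 2 - 3 * K * r + B * r\<^sup>2 < 0"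
proof -
  define S where "S = sqrt (9 * K\<^sup>2 - 8 * B)"
  \<comment> \<open>The gap is -8 times the value of the quadratic at 1, which is negative by
    hypothesis.\<close>
  have D: "(3 * K - 4)\<^sup>2 < 9 * K\<^sup>2 - 8 * B"
    using neg by (simp add: power2_eq_square algebra_simps)
  then have S2: "S\<^sup>2 = 9 * K\<^sup>2 - 8 * B"
    unfolding S_def using zero_le_power2[of "3 * K - 4"] by (subst real_sqrt_pow2) linarith+
  have "\<bar>3 * K - 4\<bar> < S"
    unfolding S_def using D real_sqrt_less_mono[OF D] by simp
  then have S: "S > 4 - 3 * K" "S > 3 * K - 4" "S > 0" by linarith+
  have \<rho>: "\<rho> = 4 / (3 * K + S)" by (simp add: \<rho>_def S_def)
  show "0 < \<rho>" "\<rho> < 1" using S K by (auto simp: \<rho> divide_simps)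
  have fac: "2 - 3 * K * r + B * r\<^sup>2 = (4 - (3 * K + S) * r) * (4 - (3 * K - S) * r) / 8" for r
  proof -
    have "8 * (2 - 3 * K * r + B * r\<^sup>2) = (4 - (3 * K + S) * r) * (4 - (3 * K - S) * r)"
      using S2 by algebra
    then show ?thesis by simp
  qed
  have pos: "4 - (3 * K - S) * r > 0" if r: "0 \<le> r" "r < 1" for r
  proof (cases "3 * K - S \<le> 0")
    case True
    then show ?thesis using r mult_nonpos_nonneg[OF True r(1)] by linarith
  next
    case False
    then have "(3 * K - S) * r \<le> (3 * K - S) * 1" using r by (intro mult_left_mono) auto
    also have "\<dots> < 4" using S by simp
    finally show ?thesis by simp
  qed
  show "2 - 3 * K * r + B * r\<^sup>2 > 0" if "0 \<le> r" "r < \<rho>" for r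
  proof -
    have "4 - (3 * K + S) * r > 0" using that S K by (simp add: \<rho> field_simps)
    moreover have "4 - (3 * K - S) * r > 0" using pos that \<open>\<rho> < 1\<close> by simp
    ultimately show ?thesis unfolding fac by simp
  qed
  show "2 - 3 * K * r + B * r\<^sup>2 < 0" if "\<rho> < r" "r < 1" for r
  proof -
    have "4 - (3 * K + S) * r < 0" using that S K by (simp add: \<rho> field_simps)
    moreover have "4 - (3 * K - S) * r > 0" using pos that \<open>0 < \<rho>\<close> by simp
    ultimately show ?thesis unfolding fac by (simp add: mult_neg_pos)
  qed
qed

lemma avoids_nephroid_curve:
  assumes q: "cmod (q - of_real a) \<le> R" and R: "R < a - 1 / 3" "R < 5 / 3 - a"
  shows "q \<notin> nephroid_map ` sphere 0 1"
proof
  assume "q \<in> nephroid_map ` sphere 0 1"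
  then obtain u where u: "cmod u = 1" and "q = nephroid_map u" by auto
  \<comment> \<open>Nonnegativity of \<open>R\<close> puts \<open>a\<close> in [1/3, 5/3], the range
    of the distance estimate.\<close>
  moreover have "0 \<le> R" using q norm_ge_zero order_trans by blast
  ultimately have "min (a - 1 / 3) (5 / 3 - a) \<le> cmod (q - of_real a)"
    using dist_nephroid_curve[OF u, of a] R by simp
  with q R show False by linarith
qed

text \<open>The hypothesis \<open>avoid\<close> says that the radius of the disc containing the
  quotient is smaller than the distance from its centre to each of the cusps 1/3 and 5/3.\<close>

lemma dilation_nephroid_starlike:
  assumes F: "F \<in> product_family \<alpha> \<beta> n" and "\<alpha> < 1" "\<beta> > 0" "n \<ge> 1"
    and r: "0 < r" "r < 1"
    and avoid: "\<And>t. 0 \<le> t \<Longrightarrow> t < r \<Longrightarrow>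
      (2 - 2 * \<alpha> + \<beta>) * t / (1 - t\<^sup>2) < (1 + (1 - 2 * \<alpha> - \<beta>) * t\<^sup>2) / (1 - t\<^sup>2) - 1 / 3 \<and>
      (2 - 2 * \<alpha> + \<beta>) * t / (1 - t\<^sup>2) < 5 / 3 - (1 + (1 - 2 * \<alpha> - \<beta>) * t\<^sup>2) / (1 - t\<^sup>2)"
  shows "(\<lambda>z. F (of_real r * z) / of_real r) \<in> nephroid_starlike"
proof -
  note Fp = product_family_disc[OF assms(1-4)]
  define G where "G = (\<lambda>z. F (of_real r * z) / of_real r)"
  note G = class_A_dilation[OF Fp(1,2) r, folded G_def]
  have nz: "\<forall>z\<in>\<bbbD> - {0}. G z \<noteq> 0" using G(2) by (simp add: G_def)
  have "starlike_quotient G z \<notin> nephroid_map ` sphere 0 1" if z: "z \<in> \<bbbD>" for z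
  proof -
    define w where "w = of_real r * z"
    have "r * cmod z < r * 1" using z r by (intro mult_strict_left_mono) auto
    then have w: "cmod w < r" using r by (simp add: w_def norm_mult)
    then have wD: "w \<in> \<bbbD>" using r by simp
    show ?thesis
      using avoids_nephroid_curve[OF Fp(3)[OF wD]] avoid[OF norm_ge_zero w] G(3)[OF z]
      by (simp add: w_def)
  qed
  then have "starlike_quotient G ` \<bbbD> \<inter> nephroid_map ` sphere 0 1 = {}" by blast
  moreover have "starlike_quotient G holomorphic_on \<bbbD>"
    by (rule holomorphic_starlike_quotient[OF G(1) nz])
  moreover have "starlike_quotient G 0 = nephroid_map 0"
    by (simp add: starlike_quotient_def nephroid_map_def)
  ultimately have "starlike_quotient G \<prec>\<^sub>D nephroid_map"
    by (intro subordinate_if_avoids_boundary holomorphic_nephroid_map inj_on_nephroid_map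
        holomorphic_on_imp_continuous_on)
  then show ?thesis
    using G(1) nz unfolding nephroid_starlike_def G_def[symmetric] by simp
qed

section \<open>The extremal function, and necessity\<close>

text \<open>This is the Koebe function of order \<alpha>, z / (1 - z)^(2 - 2\<alpha>). Its order
  comes from Re (z / (1 - z)) > -1/2 on the disk.\<close>

lemma koebe_type_starlike:
  fixes \<alpha> :: real
  assumes "\<alpha> < 1"
  defines "f \<equiv> \<lambda>z::complex. z * exp (- of_real (2 - 2 * \<alpha>) * Ln (1 - z))"
  shows "f \<in> starlike_of_order \<alpha>"
    and "\<And>z. z \<in> \<bbbD> \<Longrightarrow> starlike_quotient f z = 1 + of_real (2 - 2 * \<alpha>) * z / (1 - z)"
proof -
  have np: "1 - z \<notin> \<real>\<^sub>\<le>\<^sub>0" if "z \<in> \<bbbD>" for z :: complex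
    using that abs_Re_le_cmod[of z] by (auto simp: complex_nonpos_Reals_iff)
  have df: "(f has_field_derivative
      exp (- of_real (2 - 2 * \<alpha>) * Ln (1 - z)) * (1 + of_real (2 - 2 * \<alpha>) * z / (1 - z))) (at z)"
    if z: "z \<in> \<bbbD>" for z
  proof -
    define k where "k = complex_of_real (2 - 2 * \<alpha>)"
    have "((\<lambda>z. Ln (1 - z)) has_field_derivative - inverse (1 - z)) (at z)"
      using np[OF z] by (auto intro!: derivative_eq_intros simp: field_simps)
    then have "((\<lambda>z. z * exp (- k * Ln (1 - z))) has_field_derivative
        (1 * exp (- k * Ln (1 - z)) + exp (- k * Ln (1 - z)) * (- k * - inverse (1 - z)) * z)) (at z)"
      by (intro DERIV_mult DERIV_ident DERIV_fun_exp DERIV_cmult)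
    then show ?thesis
      unfolding f_def k_def[symmetric] by (simp add: divide_inverse algebra_simps)
  qed
  have "f holomorphic_on \<bbbD>"
    unfolding holomorphic_on_open[OF open_ball] using df by blast
  then have fA: "f \<in> class_A"
    using DERIV_imp_deriv[OF df[of 0]] by (simp add: class_A_def f_def)
  show q: "starlike_quotient f z = 1 + of_real (2 - 2 * \<alpha>) * z / (1 - z)" if "z \<in> \<bbbD>" for z
  proof (cases "z = 0")
    case False
    then show ?thesis
      unfolding starlike_quotient_def DERIV_imp_deriv[OF df[OF that]] by (simp add: f_def)
  qed (simp add: starlike_quotient_def)
  have "Re (starlike_quotient f z) > \<alpha>" if z: "z \<in> \<bbbD>" for z
  proof -
    have D: "(1 - Re z)\<^sup>2 + (Im z)\<^sup>2 > 0"
      using z abs_Re_le_cmod[of z] by (intro add_pos_nonneg) auto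
    have "(cmod z)\<^sup>2 < 1" using z by (simp add: abs_square_less_1)
    \<comment> \<open>The bound Re (z / (1 - z)) > -1/2 multiplied by |1 - z|^2 is a rearrangement
      of |z|^2 < 1.\<close>
    then have "- (1 / 2) * ((1 - Re z)\<^sup>2 + (Im z)\<^sup>2) < Re z * (1 - Re z) - (Im z)\<^sup>2"
      unfolding cmod_power2 by (simp add: power2_eq_square algebra_simps)
    then have "- (1 / 2) < Re (z / (1 - z))"
      using D by (simp add: Re_divide pos_less_divide_eq power2_eq_square algebra_simps)
    then have "(2 - 2 * \<alpha>) * - (1 / 2) < (2 - 2 * \<alpha>) * Re (z / (1 - z))"
      using assms(1) by (intro mult_strict_left_mono) auto
    moreover have "(2 - 2 * \<alpha>) * - (1 / 2) = \<alpha> - 1" by (simp add: field_simps)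
    moreover have "Re (starlike_quotient f z) = 1 + (2 - 2 * \<alpha>) * Re (z / (1 - z))"
    proof -
      have "Re (1 + of_real k * w) = 1 + k * Re w" for k w by simp
      then show ?thesis unfolding q[OF z] times_divide_eq_right[symmetric] .
    qed
    ultimately show ?thesis by linarith
  qed
  then show "f \<in> starlike_of_order \<alpha>"
    using fA by (auto simp: starlike_of_order_def f_def)
qed

text \<open>All zeros of \<open>Q\<close> sit at -1, opposite the singularity of \<open>f\<close> at
  1, so that on the real axis both summands reach the same end of their discs simultaneously: the
  right end at t, the left end at -t.\<close>

lemma extremal_product:
  assumes "\<alpha> < 1" and "n \<ge> 1"
  obtains F where "F \<in> product_family \<alpha> \<beta> n"
    and "F \<in> class_A" and "\<forall>z\<in>\<bbbD> - {0}. F z \<noteq> 0"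
    and "\<And>z. z \<in> \<bbbD> \<Longrightarrow>
      starlike_quotient F z = 1 + of_real (2 - 2 * \<alpha>) * z / (1 - z) + of_real \<beta> * z / (1 + z)"
proof -
  define f where "f = (\<lambda>z::complex. z * exp (- of_real (2 - 2 * \<alpha>) * Ln (1 - z)))"
  define Q where "Q = [:1, 1::complex:] ^ n"
  define L where "L = (\<lambda>z::complex. of_nat n * Ln (1 + z))"
  define g where "g = (\<lambda>z. exp (of_real (\<beta> / real n) * L z))"
  note f = koebe_type_starlike[OF assms(1), folded f_def]
  have fA: "f \<in> class_A" "\<forall>z\<in>\<bbbD> - {0}. f z \<noteq> 0"
    using f(1) by (auto simp: starlike_of_order_def)
  have np: "1 + z \<notin> \<real>\<^sub>\<le>\<^sub>0" if "z \<in> \<bbbD>" for z :: complex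
    using that abs_Re_le_cmod[of z] by (auto simp: complex_nonpos_Reals_iff)
  have nz: "1 + z \<noteq> 0" if "z \<in> \<bbbD>" for z :: complex
    using np[OF that] by force
  have pQ: "poly Q z = (1 + z) ^ n" for z by (simp add: Q_def)
  have "L holomorphic_on \<bbbD>"
    unfolding L_def using np by (intro holomorphic_intros) auto
  moreover have "exp (L z) = poly Q z" if "z \<in> \<bbbD>" for z
    unfolding L_def pQ exp_of_nat_mult using nz[OF that] by simp
  moreover have "g 0 = 1" by (simp add: g_def L_def)
  ultimately have g: "is_power_branch (poly Q) (\<beta> / real n) g"
    unfolding is_power_branch_def g_def by blast
  have Q: "degree Q = n" "poly Q 0 = 1" "\<And>z. poly Q z = 0 \<Longrightarrow> z \<notin> \<bbbD>"
    using nz by (auto simp: Q_def degree_linear_power pQ)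
  define F where "F = (\<lambda>z. f z * g z)"
  have Ff: "F \<in> product_family \<alpha> \<beta> n"
    unfolding product_family_def using f(1) Q g by (auto simp: F_def)
  have "\<forall>z\<in>\<bbbD>. F z = f z * g z" by (simp add: F_def)
  note prod = starlike_quotient_product[OF fA g this]
  have "starlike_quotient F z = 1 + of_real (2 - 2 * \<alpha>) * z / (1 - z) + of_real \<beta> * z / (1 + z)"
    if z: "z \<in> \<bbbD>" for z
  proof -
    obtain m where m: "n = Suc m" using assms(2) by (cases n) auto
    have "poly (pderiv Q) z = of_nat n * (1 + z) ^ m"
      unfolding Q_def m pderiv_power_Suc by (simp add: pderiv_pCons)
    moreover have "poly Q z = (1 + z) * (1 + z) ^ m"
      unfolding pQ m by simp
    ultimately have "z * poly (pderiv Q) z / poly Q z = of_nat n * z / (1 + z)"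
      using nz[OF z] by simp
    moreover have "of_real (\<beta> / real n) * (of_nat n * z / (1 + z)) = of_real \<beta> * z / (1 + z)"
      using assms(2) by simp
    ultimately show ?thesis
      using prod(3)[OF z] f(2)[OF z] by simp
  qed
  then show ?thesis
    using that Ff prod(1,2) by blast
qed

lemma nephroid_starlike_dilation_real_value:
  assumes F: "F \<in> class_A" "\<forall>z\<in>\<bbbD> - {0}. F z \<noteq> 0"
    and r: "0 < r" "r < 1" and x: "\<bar>x\<bar> < r" "starlike_quotient F (of_real x) = of_real v"
    and S: "(\<lambda>z. F (of_real r * z) / of_real r) \<in> nephroid_starlike"
  shows "1 / 3 < v" and "v < 5 / 3"
proof -
  \<comment> \<open>The dilation by r moves the sample point x to x/r.\<close>
  have D: "of_real (x / r) \<in> \<bbbD>" using x r by (simp add: norm_divide del: of_real_divide)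
  from S obtain w where w: "w ` \<bbbD> \<subseteq> \<bbbD>" and
    eq: "\<And>z. z \<in> \<bbbD> \<Longrightarrow> starlike_quotient (\<lambda>z. F (of_real r * z) / of_real r) z = nephroid_map (w z)"
    unfolding nephroid_starlike_def subordinate_def by blast
  have "of_real v = nephroid_map (w (of_real (x / r)))"
    using eq[OF D] class_A_dilation(3)[OF F r D] x(2) r by simp
  moreover have "w (of_real (x / r)) \<in> \<bbbD>" using w D by blast
  ultimately show "1 / 3 < v" "v < 5 / 3"
    using real_value_nephroid_map by metis+
qed

section \<open>The sharp radius, from the disc bound and the extremal function\<close>

theorem theorem6p2:
  fixes \<alpha> \<beta> :: real and n :: nat
  assumes "0 \<le> \<alpha>" and "\<alpha> < 1" and "\<beta> > 0" and "n \<ge> 1"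
  shows "is_class_radius nephroid_starlike (product_family \<alpha> \<beta> n)
    (if 2 * \<alpha> + \<beta> - 2 \<ge> 0
     then 4 / (3 * (2 - 2 * \<alpha> + \<beta>)
               + sqrt (9 * (- 2 + 2 * \<alpha> - \<beta>)\<^sup>2 - 8 * (4 - 6 * \<alpha> - 3 * \<beta>)))
     else 4 / (3 * (2 - 2 * \<alpha> + \<beta>)
               + sqrt (9 * (- 2 + 2 * \<alpha> - \<beta>)\<^sup>2 - 8 * (6 * \<alpha> - 8 + 3 * \<beta>))))"
proof -
  define K where "K = 2 - 2 * \<alpha> + \<beta>"
  \<comment> \<open>The cusps 1/3 and 5/3 give the conditions 2 - 3Kt + bt^2 > 0 with b = 4 -
    6\<alpha> - 3\<beta> and b = 6\<alpha> - 8 + 3\<beta>. These differ by -6 (2\<alpha> + \<beta> -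
    2), so \<open>B\<close> is the smaller one and gives the stricter condition.\<close>
  define B where "B = (if 2 * \<alpha> + \<beta> - 2 \<ge> 0 then 4 - 6 * \<alpha> - 3 * \<beta> else 6 * \<alpha> - 8 + 3 * \<beta>)"
  define \<rho> where "\<rho> = 4 / (3 * K + sqrt (9 * K\<^sup>2 - 8 * B))"
  have K: "K > 0" using assms by (simp add: K_def)
  \<comment> \<open>The value at 1 is -6\<beta> in the first case and -12 (1 - \<alpha>) in the
    second.\<close>
  have "2 - 3 * K + B < 0" using assms by (simp add: K_def B_def)
  note root = quadratic_root_sign[OF K this, folded \<rho>_def]
  have "\<rho> \<in> admissible_radii nephroid_starlike (product_family \<alpha> \<beta> n)"
    unfolding admissible_radii_def
  proof (intro CollectI conjI ballI allI impI)
    fix F r assume F: "F \<in> product_family \<alpha> \<beta> n" and r: "0 < r \<and> r < \<rho>"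
    have "(2 - 2 * \<alpha> + \<beta>) * t / (1 - t\<^sup>2) < (1 + (1 - 2 * \<alpha> - \<beta>) * t\<^sup>2) / (1 - t\<^sup>2) - 1 / 3 \<and>
      (2 - 2 * \<alpha> + \<beta>) * t / (1 - t\<^sup>2) < 5 / 3 - (1 + (1 - 2 * \<alpha> - \<beta>) * t\<^sup>2) / (1 - t\<^sup>2)"
      if t: "0 \<le> t" "t < r" for t
    proof -
      have s: "0 < 1 - t\<^sup>2"
        using t r root(2) by (simp add: power_less_one_iff)
      have "0 < 2 - 3 * K * t + B * t\<^sup>2"
        using root(3) t r by simp
      moreover have "B * t\<^sup>2 \<le> (4 - 6 * \<alpha> - 3 * \<beta>) * t\<^sup>2" "B * t\<^sup>2 \<le> (6 * \<alpha> - 8 + 3 * \<beta>) * t\<^sup>2"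
        by (auto intro!: mult_right_mono simp: B_def)
      ultimately have "0 < 2 - 3 * K * t + (4 - 6 * \<alpha> - 3 * \<beta>) * t\<^sup>2"
        "0 < 2 - 3 * K * t + (6 * \<alpha> - 8 + 3 * \<beta>) * t\<^sup>2" by linarith+
      then have "0 < (2 - 3 * K * t + (4 - 6 * \<alpha> - 3 * \<beta>) * t\<^sup>2) / (3 * (1 - t\<^sup>2))"
        "0 < (2 - 3 * K * t + (6 * \<alpha> - 8 + 3 * \<beta>) * t\<^sup>2) / (3 * (1 - t\<^sup>2))"
        using s by simp_all
      moreover have "(2 - 3 * K * t + (4 - 6 * \<alpha> - 3 * \<beta>) * t\<^sup>2) / (3 * (1 - t\<^sup>2))
          = (1 + (1 - 2 * \<alpha> - \<beta>) * t\<^sup>2) / (1 - t\<^sup>2) - 1 / 3 - (2 - 2 * \<alpha> + \<beta>) * t / (1 - t\<^sup>2)"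
        "(2 - 3 * K * t + (6 * \<alpha> - 8 + 3 * \<beta>) * t\<^sup>2) / (3 * (1 - t\<^sup>2))
          = 5 / 3 - (1 + (1 - 2 * \<alpha> - \<beta>) * t\<^sup>2) / (1 - t\<^sup>2) - (2 - 2 * \<alpha> + \<beta>) * t / (1 - t\<^sup>2)"
        using s by (simp_all add: K_def divide_simps) (simp_all add: algebra_simps)
      ultimately show ?thesis by linarith
    qed
    then show "(\<lambda>z. F (of_real r * z) / of_real r) \<in> nephroid_starlike"
      using r root(2) by (intro dilation_nephroid_starlike[OF F]) (use assms in auto)
  qed (use root in auto)
  moreover have "R \<le> \<rho>" if R: "R \<in> admissible_radii nephroid_starlike (product_family \<alpha> \<beta> n)" for R
  proof (rule ccontr)
    assume "\<not> R \<le> \<rho>"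
    \<comment> \<open>Two intermediate points are needed: the dilation factor r must stay below R,
      and the sample point t must lie strictly between \<open>\<rho>\<close> and r.\<close>
    then obtain r where r: "\<rho> < r" "r < R" using dense not_le by metis
    then obtain t where t: "\<rho> < t" "t < r" using dense by blast
    have R1: "R < 1" using R by (simp add: admissible_radii_def)
    obtain F where F: "F \<in> product_family \<alpha> \<beta> n"
      and FA: "F \<in> class_A" "\<forall>z\<in>\<bbbD> - {0}. F z \<noteq> 0"
      and q: "\<And>z. z \<in> \<bbbD> \<Longrightarrow>
        starlike_quotient F z = 1 + of_real (2 - 2 * \<alpha>) * z / (1 - z) + of_real \<beta> * z / (1 + z)"
      using extremal_product assms by metis
    have S: "(\<lambda>z. F (of_real r * z) / of_real r) \<in> nephroid_starlike"
      using R F r root(1) by (auto simp: admissible_radii_def)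
    have val: "starlike_quotient F (of_real x)
        = of_real (1 + (2 - 2 * \<alpha>) * x / (1 - x) + \<beta> * x / (1 + x))" if "\<bar>x\<bar> < r" for x
      using that r R1 by (subst q) auto
    note range = nephroid_starlike_dilation_real_value[OF FA _ _ _ val S]
    have neg: "2 - 3 * K * t + B * t\<^sup>2 < 0"
      using root(4) t r R1 by simp
    have tt: "0 < t" "t < 1" using t r R1 root(1) by auto
    have dpos: "3 * (1 + t) * (1 - t) > 0" using tt by simp
    have t0: "\<bar>t\<bar> < r" "\<bar>- t\<bar> < r" "0 < r" "r < 1" using t r R1 root(1) by auto
    show False
    proof (cases "2 * \<alpha> + \<beta> - 2 \<ge> 0")
      case True
      \<comment> \<open>At -t the extremal quotient is the left end of the disc, tested against the
        cusp 1/3.\<close>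
      have "1 / 3 < 1 + (2 - 2 * \<alpha>) * - t / (1 - - t) + \<beta> * - t / (1 + - t)"
        using range(1)[of "- t"] t0 by simp
      moreover have "1 + (2 - 2 * \<alpha>) * - t / (1 - - t) + \<beta> * - t / (1 + - t) - 1 / 3
          = (2 - 3 * K * t + (4 - 6 * \<alpha> - 3 * \<beta>) * t\<^sup>2) / (3 * (1 + t) * (1 - t))"
        using tt by (simp add: K_def divide_simps) (simp add: power2_eq_square algebra_simps)
      ultimately have "0 < (2 - 3 * K * t + (4 - 6 * \<alpha> - 3 * \<beta>) * t\<^sup>2) / (3 * (1 + t) * (1 - t))"
        by linarith
      then have "0 < 2 - 3 * K * t + (4 - 6 * \<alpha> - 3 * \<beta>) * t\<^sup>2"
        using dpos by (simp only: zero_less_divide_iff) auto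
      with neg True show False by (simp add: B_def)
    next
      case False
      \<comment> \<open>At t it is the right end, tested against the cusp 5/3.\<close>
      have "1 + (2 - 2 * \<alpha>) * t / (1 - t) + \<beta> * t / (1 + t) < 5 / 3"
        using range(2)[of t] t0 by simp
      moreover have "5 / 3 - (1 + (2 - 2 * \<alpha>) * t / (1 - t) + \<beta> * t / (1 + t))
          = (2 - 3 * K * t + (6 * \<alpha> - 8 + 3 * \<beta>) * t\<^sup>2) / (3 * (1 + t) * (1 - t))"
        using tt by (simp add: K_def divide_simps) (simp add: power2_eq_square algebra_simps)
      ultimately have "0 < (2 - 3 * K * t + (6 * \<alpha> - 8 + 3 * \<beta>) * t\<^sup>2) / (3 * (1 + t) * (1 - t))"
        by linarith
      then have "0 < 2 - 3 * K * t + (6 * \<alpha> - 8 + 3 * \<beta>) * t\<^sup>2"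
        using dpos by (simp only: zero_less_divide_iff) auto
      with neg False show False by (simp add: B_def)
    qed
  qed
  moreover have "(- 2 + 2 * \<alpha> - \<beta>)\<^sup>2 = K\<^sup>2"
    by (simp add: K_def power2_eq_square algebra_simps)
  ultimately show ?thesis
    unfolding is_class_radius_def K_def[symmetric]
    by (cases "2 * \<alpha> + \<beta> - 2 \<ge> 0") (simp_all add: \<rho>_def B_def)
qed

end
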